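(* (a) Let $S$ be a semigroup. For each $x\in S$ let $T_x\neq\emptyset$ be a set, and assume $T_x\cap T_y=\emptyset$ for all $x\neq y$ in $S$. Assume that to each triple $(x,y,xy)\in S\times S\times S$ (i.e. for all $x,y\in S$) there is associated a mapping $f_{(x,y,xy)}: T_x\to T_{xy}$ (acting on the left), and suppose that $$f_{(xy,z,xyz)}\circ f_{(x,y,xy)}=f_{(x,yz,xyz)}$$ for all triples $(x,y,z)\in S\times S\times S$. Let $T=\bigcup_{x\in S}T_x$ and, for $a,b\in T$, set $a\circ b=f_{(x,y,xy)}(a)$, where $a\in T_x$ and $b\in T_y$. Then $(T;\circ)$ is a semigroup, and each set $T_x$ ($x\in S$) is contained in a $\theta(T)$-class of the semigroup $(T;\circ)$. If $S$ is left reductive, then the $\theta(T)$-classes of the semigroup $(T;\circ)$ are exactly the sets $T_x$ ($x\in S$). (b) Let $(T;\cdot)$ be a semigroup, let $\theta$ denote the congruence $\theta(T)$ of $(T;\cdot)$, and let $S=T/\theta$ be the factor semigroup. For $[x]\theta\in S$ let $T_{[x]\theta}$ be the $\theta$-class $[x]\theta$ regarded as a subset of $T$. For every triple $([x]\theta,[y]\theta,[x\cdot y]\theta)\in S\times S\times S$ let $$f_{([x]\theta,[y]\theta,[x\cdot y]\theta)}: a\mapsto a\cdot b\qquad(a\in[x]\theta),$$ where $b$ is an arbitrary element of $[y]\theta$ (the value $a\cdot b$ does not depend on the choice of $b$ in $[y]\theta$; a mapping is taken separately for each pair $([x]\theta,[y]\theta)$, even when different second components yield the same product). For all $c,d\in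 T$ let $c\circ d=f_{([c]\theta,[d]\theta,[c\cdot d]\theta)}(c)$. Then $(T;\circ)$ is a semigroup which is isomorphic to the semigroup $(T;\cdot)$. Consequently, every semigroup $(T;\cdot)$ is isomorphic to a semigroup derived from the semigroup $S=T/\theta(T)$ using the construction in part (a).
   Context: For a semigroup $S$, the relation $\theta(S)$ on $S$ is defined by: $(a,b)\in\theta(S)$ if and only if $xa=xb$ for all $x\in S$. It is a congruence on $S$. The class of $x$ modulo a congruence $\theta$ is denoted $[x]\theta$. A semigroup $S$ is called left reductive if, for all $a,b\in S$, whenever $xa=xb$ holds for all $x\in S$ then $a=b$. Composition of mappings acting on the left is $(g\circ f)(a)=g(f(a))$. In part (a), the semigroup $(T;\circ)$ is said to be derived from $S$ by the construction. *)

theory Defs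
  imports "HOL-Library.FuncSet" "HOL-Library.Disjoint_Sets"
begin

text \<open>
  Semigroups are given by an explicit carrier set and an operation on the ambient type, because
  factor semigroups and unions of indexed families of sets do not live on whole types.
  The empty carrier is allowed.
\<close>

locale semigroup_on =
  fixes A :: "'a set" and m :: "'a \<Rightarrow> 'a \<Rightarrow> 'a"
  assumes closed: "\<lbrakk>a \<in> A; b \<in> A\<rbrakk> \<Longrightarrow> m a b \<in> A"
    and assoc: "\<lbrakk>a \<in> A; b \<in> A; c \<in> A\<rbrakk> \<Longrightarrow> m (m a b) c = m a (m b c)"

definition congruence_on :: "'a set \<Rightarrow> ('a \<Rightarrow> 'a \<Rightarrow> 'a) \<Rightarrow> ('a \<times> 'a) set \<Rightarrow> bool" where
  "congruence_on A m r \<longleftrightarrow> equiv A r \<and>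
     (\<forall>a b c d. (a, b) \<in> r \<longrightarrow> (c, d) \<in> r \<longrightarrow> (m a c, m b d) \<in> r)"

definition theta :: "'a set \<Rightarrow> ('a \<Rightarrow> 'a \<Rightarrow> 'a) \<Rightarrow> ('a \<times> 'a) set" where
  "theta A m = {(a, b). a \<in> A \<and> b \<in> A \<and> (\<forall>x\<in>A. m x a = m x b)}"

definition left_reductive :: "'a set \<Rightarrow> ('a \<Rightarrow> 'a \<Rightarrow> 'a) \<Rightarrow> bool" where
  "left_reductive A m \<longleftrightarrow> (\<forall>a\<in>A. \<forall>b\<in>A. (\<forall>x\<in>A. m x a = m x b) \<longrightarrow> a = b)"

text \<open>
  The operation of the factor semigroup on \<open>A // r\<close>. For a congruence \<open>r\<close> all the classes in
  the union coincide, so that the product of the classes of \<open>a\<close> and \<open>b\<close> is the class of \<open>m a b\<close>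
  (lemma \<open>factor_mult_class\<close>).
\<close>

definition factor_mult :: "('a \<times> 'a) set \<Rightarrow> ('a \<Rightarrow> 'a \<Rightarrow> 'a) \<Rightarrow> 'a set \<Rightarrow> 'a set \<Rightarrow> 'a set" where
  "factor_mult r m X Y = (\<Union>a\<in>X. \<Union>b\<in>Y. r `` {m a b})"

lemma factor_mult_class:
  assumes "congruence_on A m r" "a \<in> A" "b \<in> A"
  shows "factor_mult r m (r `` {a}) (r `` {b}) = r `` {m a b}"
proof -
  have eq: "equiv A r" and c: "\<And>a b c d. (a, b) \<in> r \<Longrightarrow> (c, d) \<in> r \<Longrightarrow> (m a c, m b d) \<in> r"
    using assms(1) by (auto simp: congruence_on_def)
  have "congruent2 r r (\<lambda>x y. r `` {m x y})"
    unfolding congruent2_def using c equiv_class_eq[OF eq] by blast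
  from UN_equiv_class2[OF eq eq this assms(2,3)] show ?thesis
    by (simp add: factor_mult_def)
qed

definition isomorphic_on ::
    "'a set \<Rightarrow> ('a \<Rightarrow> 'a \<Rightarrow> 'a) \<Rightarrow> 'b set \<Rightarrow> ('b \<Rightarrow> 'b \<Rightarrow> 'b) \<Rightarrow> bool" where
  "isomorphic_on A m B n \<longleftrightarrow>
     (\<exists>h. bij_betw h A B \<and> (\<forall>x\<in>A. \<forall>y\<in>A. h (m x y) = n (h x) (h y)))"

text \<open>
  The mappings \<open>f\<close> are indexed by triples; only the triples \<open>(x, y, m x y)\<close> with \<open>x, y \<in> S\<close>
  are relevant.
\<close>

locale semigroup_construction = semigroup_on S m
  for S :: "'s set" and m :: "'s \<Rightarrow> 's \<Rightarrow> 's" +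
  fixes T :: "'s \<Rightarrow> 't set" and f :: "'s \<times> 's \<times> 's \<Rightarrow> 't \<Rightarrow> 't"
  assumes nonempty: "x \<in> S \<Longrightarrow> T x \<noteq> {}"
    and disjoint: "disjoint_family_on T S"
    and maps: "\<lbrakk>x \<in> S; y \<in> S\<rbrakk> \<Longrightarrow> f (x, y, m x y) \<in> T x \<rightarrow> T (m x y)"
    and comp: "\<lbrakk>x \<in> S; y \<in> S; z \<in> S; a \<in> T x\<rbrakk> \<Longrightarrow>
      (f (m x y, z, m (m x y) z) \<circ> f (x, y, m x y)) a = f (x, m y z, m x (m y z)) a"

definition index_of :: "'s set \<Rightarrow> ('s \<Rightarrow> 't set) \<Rightarrow> 't \<Rightarrow> 's" where
  "index_of S T a = (THE x. x \<in> S \<and> a \<in> T x)"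

definition derived_mult ::
    "'s set \<Rightarrow> ('s \<Rightarrow> 's \<Rightarrow> 's) \<Rightarrow> ('s \<Rightarrow> 't set) \<Rightarrow> ('s \<times> 's \<times> 's \<Rightarrow> 't \<Rightarrow> 't) \<Rightarrow> 't \<Rightarrow> 't \<Rightarrow> 't" where
  "derived_mult S m T f a b =
     (let x = index_of S T a; y = index_of S T b in f (x, y, m x y) a)"

context semigroup_construction
begin

lemma index_of_eq: "\<lbrakk>x \<in> S; a \<in> T x\<rbrakk> \<Longrightarrow> index_of S T a = x"
  using disjoint unfolding index_of_def disjoint_family_on_def by blast

lemma derived_mult_eq:
  "\<lbrakk>x \<in> S; y \<in> S; a \<in> T x; b \<in> T y\<rbrakk> \<Longrightarrow> derived_mult S m T f a b = f (x, y, m x y) a"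
  by (simp add: derived_mult_def index_of_eq)

end

text \<open>
  The mapping \<open>a \<mapsto> a \<cdot> b\<close> attached to a triple of classes \<open>(X, Y, Z)\<close>, where \<open>b = rep X Y\<close> is
  the element chosen in the class \<open>Y\<close>.
\<close>

definition class_translation ::
    "('a \<Rightarrow> 'a \<Rightarrow> 'a) \<Rightarrow> ('a set \<Rightarrow> 'a set \<Rightarrow> 'a) \<Rightarrow> 'a set \<times> 'a set \<times> 'a set \<Rightarrow> 'a \<Rightarrow> 'a" where
  "class_translation m rep = (\<lambda>(X, Y, Z) a. m a (rep X Y))"

end

theory Submission
  imports Defs
begin

text \<open>
  A pair lies in \<open>\<theta>\<close> when its two elements act identically by multiplication from the right, so
  the product \<open>a b\<close> depends on \<open>b\<close> only through its \<open>\<theta>\<close>-class. Both parts unfold this remark.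

  In the construction, \<open>a \<circ> b\<close> depends on \<open>b\<close> only through the index \<open>y\<close> with \<open>b \<in> T\<^sub>y\<close>, which
  puts each \<open>T\<^sub>y\<close> inside one \<open>\<theta>\<close>-class, and the composition rule for the maps \<open>f\<close> is associativity
  read off on indices. Conversely, the product of an element of \<open>T\<^sub>z\<close> with an element of \<open>T\<^sub>x\<close>
  lies in the set with index \<open>z x\<close>. As these sets are disjoint, \<open>\<theta>\<close>-equivalent elements with indices
  \<open>x\<close> and \<open>y\<close> satisfy \<open>z x = z y\<close> for all \<open>z\<close>, and left reductivity of \<open>S\<close> gives \<open>x = y\<close>
  (\<open>theta_derived_iff\<close>).

  For a given semigroup, choose a representative of every \<open>\<theta>\<close>-class and translate by it. By the
  remark the choice is immaterial, and both required identities, that the translations compose as the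
  construction demands (\<open>construction_of_classes\<close>) and that the operation derived from them is the
  original one (\<open>derived_mult_of_classes\<close>), follow by replacing representatives with other
  elements of the same class. The isomorphisms are identity maps.
\<close>

section \<open>Semigroups derived by the construction\<close>

context semigroup_construction
begin

abbreviation carrier where "carrier \<equiv> \<Union>x\<in>S. T x"
abbreviation dot where "dot \<equiv> derived_mult S m T f"

lemma derived_mult_mem:
  assumes "x \<in> S" "y \<in> S" "a \<in> T x" "b \<in> T y"
  shows "dot a b \<in> T (m x y)"
  using maps[OF assms(1,2)] derived_mult_eq[OF assms] assms(3) by auto

lemma index_unique: "\<lbrakk>x \<in> S; y \<in> S; a \<in> T x; a \<in> T y\<rbrakk> \<Longrightarrow> x = y"
  using index_of_eq by metis

lemma semigroup_derived: "semigroup_on carrier dot"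
proof
  fix a b assume "a \<in> carrier" "b \<in> carrier"
  then obtain x y where xy: "x \<in> S" "y \<in> S" "a \<in> T x" "b \<in> T y" by blast
  show "dot a b \<in> carrier"
    using derived_mult_mem[OF xy] closed[OF xy(1,2)] by blast
next
  fix a b c assume "a \<in> carrier" "b \<in> carrier" "c \<in> carrier"
  then obtain x y z where S: "x \<in> S" "y \<in> S" "z \<in> S"
    and T: "a \<in> T x" "b \<in> T y" "c \<in> T z" by blast
  have "dot (dot a b) c = f (m x y, z, m (m x y) z) (f (x, y, m x y) a)"
    using derived_mult_eq[OF closed[OF S(1,2)] S(3) derived_mult_mem[OF S(1,2) T(1,2)] T(3)]
      derived_mult_eq[OF S(1,2) T(1,2)] by simp
  also have "\<dots> = f (x, m y z, m x (m y z)) a"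
    using comp[OF S T(1)] by simp
  also have "\<dots> = dot a (dot b c)"
    using derived_mult_eq[OF S(1) closed[OF S(2,3)] T(1) derived_mult_mem[OF S(2,3) T(2,3)]] by simp
  finally show "dot (dot a b) c = dot a (dot b c)" .
qed

lemma theta_derived_if_same_index:
  assumes "x \<in> S" "a \<in> T x" "b \<in> T x"
  shows "(a, b) \<in> theta carrier dot"
proof -
  have "dot c a = dot c b" if "c \<in> carrier" for c
    using that assms by (auto simp: derived_mult_eq)
  then show ?thesis
    using assms by (auto simp: theta_def)
qed

text \<open>
  By left reductivity, distinct indices are separated by some left factor \<open>z\<close>. Any element of the
  nonempty set \<open>T\<^sub>z\<close> then separates the corresponding elements, since the two products lie in
  disjoint sets.
\<close>

lemma theta_derived_iff:
  assumes "left_reductive S m" "x \<in> S" "a \<in> T x"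
  shows "(a, b) \<in> theta carrier dot \<longleftrightarrow> b \<in> T x"
proof
  assume ab: "(a, b) \<in> theta carrier dot"
  then obtain y where y: "y \<in> S" "b \<in> T y" by (auto simp: theta_def)
  have "m z x = m z y" if z: "z \<in> S" for z
  proof -
    obtain c where c: "c \<in> T z" using nonempty[OF z] by blast
    have "dot c a = dot c b" using ab z c unfolding theta_def by blast
    then have "dot c a \<in> T (m z x)" "dot c a \<in> T (m z y)"
      using derived_mult_mem[OF z assms(2) c assms(3)] derived_mult_mem[OF z y(1) c y(2)] by auto
    then show ?thesis
      using index_unique closed z assms(2) y(1) by blast
  qed
  then have "x = y"
    using assms(1,2) y(1) unfolding left_reductive_def by blast
  then show "b \<in> T x" using y by simp
next
  assume "b \<in> T x"
  then show "(a, b) \<in> theta carrier dot"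
    using theta_derived_if_same_index assms(2,3) by blast
qed

lemma index_set_in_theta_class:
  assumes "x \<in> S"
  shows "\<exists>C \<in> carrier // theta carrier dot. T x \<subseteq> C"
proof -
  obtain a where a: "a \<in> T x" using nonempty[OF assms] by blast
  have "T x \<subseteq> theta carrier dot `` {a}"
    using theta_derived_if_same_index[OF assms a] by blast
  moreover have "theta carrier dot `` {a} \<in> carrier // theta carrier dot"
    using a assms by (blast intro: quotientI)
  ultimately show ?thesis by blast
qed

lemma theta_classes_of_derived:
  assumes "left_reductive S m"
  shows "carrier // theta carrier dot = T ` S"
proof -
  have cls: "theta carrier dot `` {a} = T x" if "x \<in> S" "a \<in> T x" for x a
    using theta_derived_iff[OF assms that] by blast
  show ?thesis
  proof
    show "carrier // theta carrier dot \<subseteq> T ` S"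
      by (auto simp: cls elim!: quotientE)
    show "T ` S \<subseteq> carrier // theta carrier dot"
    proof
      fix C assume "C \<in> T ` S"
      then obtain x a where x: "x \<in> S" "C = T x" "a \<in> T x" using nonempty by blast
      then have "C = theta carrier dot `` {a}" "a \<in> carrier" using cls by auto
      then show "C \<in> carrier // theta carrier dot" by (blast intro: quotientI)
    qed
  qed
qed

end

section \<open>Recovering a semigroup from its quotient by \<open>\<theta>\<close>\<close>

lemma isomorphic_on_id:
  assumes "\<And>a b. \<lbrakk>a \<in> A; b \<in> A\<rbrakk> \<Longrightarrow> m a b = n a b"
  shows "isomorphic_on A m A n"
  unfolding isomorphic_on_def by (rule exI[of _ id]) (simp add: assms)

context semigroup_on
begin

abbreviation \<theta> where "\<theta> \<equiv> theta A m"
abbreviation Q where "Q \<equiv> A // \<theta>"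
abbreviation mQ where "mQ \<equiv> factor_mult \<theta> m"

lemma theta_mult_cong: "\<lbrakk>(b, b') \<in> \<theta>; a \<in> A\<rbrakk> \<Longrightarrow> m a b = m a b'"
  by (auto simp: theta_def)

lemma equiv_theta: "equiv A \<theta>"
  by (rule equivI) (auto simp: theta_def refl_on_def sym_def trans_def)

text \<open>
  For \<open>(a, b), (c, d) \<in> \<theta>\<close> one has \<open>x (a c) = (x a) c = (x b) c = (x b) d = x (b d)\<close>: the first
  pair is used with left factor \<open>x\<close>, the second with left factor \<open>x b\<close>.
\<close>

lemma congruence_theta: "congruence_on A m \<theta>"
proof -
  have "(m a c, m b d) \<in> \<theta>" if ab: "(a, b) \<in> \<theta>" and cd: "(c, d) \<in> \<theta>" for a b c d
  proof -
    have A: "a \<in> A" "b \<in> A" "c \<in> A" "d \<in> A" using ab cd by (auto simp: theta_def)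
    have "m x (m a c) = m x (m b d)" if x: "x \<in> A" for x
    proof -
      have "m x (m a c) = m (m x b) c"
        using assoc[OF x A(1,3)] theta_mult_cong[OF ab x] by simp
      also have "\<dots> = m (m x b) d"
        using theta_mult_cong[OF cd closed[OF x A(2)]] .
      finally show ?thesis using assoc[OF x A(2,4)] by simp
    qed
    then show ?thesis using A closed by (auto simp: theta_def)
  qed
  then show ?thesis using equiv_theta by (auto simp: congruence_on_def)
qed

lemma class_eq: "\<lbrakk>X \<in> Q; a \<in> X\<rbrakk> \<Longrightarrow> a \<in> A \<and> X = \<theta> `` {a}"
proof (erule quotientE)
  fix b assume "a \<in> X" "X = \<theta> `` {b}"
  then have "(b, a) \<in> \<theta>" "X = \<theta> `` {b}" by auto
  then show "a \<in> A \<and> X = \<theta> `` {a}"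
    using equiv_class_eq[OF equiv_theta] by (auto simp: theta_def)
qed

lemma mem_own_class: "a \<in> A \<Longrightarrow> a \<in> \<theta> `` {a}"
  using equiv_class_self[OF equiv_theta] .

lemma mult_cong_right:
  assumes "Y \<in> Q" "a \<in> A" "b \<in> Y" "b' \<in> Y"
  shows "m a b = m a b'"
proof -
  have "(b, b') \<in> \<theta>" using class_eq[OF assms(1,3)] assms(4) by blast
  then show ?thesis using theta_mult_cong assms(2) by blast
qed

lemma factor_mult_eq:
  assumes "X \<in> Q" "Y \<in> Q" "a \<in> X" "b \<in> Y"
  shows "mQ X Y = \<theta> `` {m a b}"
  using factor_mult_class[OF congruence_theta] class_eq[OF assms(1,3)] class_eq[OF assms(2,4)]
  by simp

lemma factor_mult_mem:
  assumes "X \<in> Q" "Y \<in> Q" "a \<in> X" "b \<in> Y"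
  shows "m a b \<in> mQ X Y"
  using factor_mult_eq[OF assms] mem_own_class closed class_eq[OF assms(1,3)] class_eq[OF assms(2,4)]
  by simp

lemma class_nonempty: "X \<in> Q \<Longrightarrow> X \<noteq> {}"
  using in_quotient_imp_non_empty[OF equiv_theta] .

lemma semigroup_factor: "semigroup_on Q mQ"
proof
  fix X Y assume XY: "X \<in> Q" "Y \<in> Q"
  then obtain a b where ab: "a \<in> X" "b \<in> Y" using class_nonempty by blast
  then have "m a b \<in> A" using XY class_eq closed by simp
  then show "mQ X Y \<in> Q"
    using factor_mult_eq[OF XY ab] by (simp add: quotientI)
next
  fix X Y Z assume XYZ: "X \<in> Q" "Y \<in> Q" "Z \<in> Q"
  then have "X \<noteq> {}" "Y \<noteq> {}" "Z \<noteq> {}" by (simp_all add: class_nonempty)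
  then obtain a b c where el: "a \<in> X" "b \<in> Y" "c \<in> Z" by blast
  note cls = class_eq[OF XYZ(1) el(1)] class_eq[OF XYZ(2) el(2)] class_eq[OF XYZ(3) el(3)]
  have A: "a \<in> A" "b \<in> A" "c \<in> A" using cls by simp_all
  have eqs: "X = \<theta> `` {a}" "Y = \<theta> `` {b}" "Z = \<theta> `` {c}" using cls by simp_all
  show "mQ (mQ X Y) Z = mQ X (mQ Y Z)"
    by (simp only: eqs factor_mult_class[OF congruence_theta] A closed assoc)
qed

text \<open>
  In the composition rule the left side multiplies by representatives of \<open>Y\<close> and of \<open>Z\<close> in turn,
  the right side by a representative of the product class. The product of the former two lies in that
  class too, so it may replace the latter.
\<close>

lemma construction_of_classes:
  assumes rep: "\<And>X Y. \<lbrakk>X \<in> Q; Y \<in> Q\<rbrakk> \<Longrightarrow> rep X Y \<in> Y"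
  shows "semigroup_construction Q mQ (\<lambda>X. X) (class_translation m rep)"
proof -
  interpret Q: semigroup_on Q mQ by (rule semigroup_factor)
  show ?thesis
  proof
    fix X assume "X \<in> Q"
    then show "X \<noteq> {}" by (rule class_nonempty)
  next
    show "disjoint_family_on (\<lambda>X. X) Q"
      using quotient_disj[OF equiv_theta] by (auto simp: disjoint_family_on_def)
  next
    fix X Y assume "X \<in> Q" "Y \<in> Q"
    then show "class_translation m rep (X, Y, mQ X Y) \<in> X \<rightarrow> mQ X Y"
      by (auto simp: class_translation_def intro: factor_mult_mem rep)
  next
    fix X Y Z a assume Q: "X \<in> Q" "Y \<in> Q" "Z \<in> Q" and a: "a \<in> X"
    let ?b = "rep X Y" and ?c = "rep (mQ X Y) Z" and ?d = "rep X (mQ Y Z)"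
    have mem: "?b \<in> Y" "?c \<in> Z" "?d \<in> mQ Y Z"
      using Q rep Q.closed by auto
    have A: "a \<in> A" "?b \<in> A" "?c \<in> A"
      using class_eq[OF Q(1) a] class_eq[OF Q(2) mem(1)] class_eq[OF Q(3) mem(2)] by simp_all
    have "m (m a ?b) ?c = m a (m ?b ?c)"
      using assoc A by blast
    also have "\<dots> = m a ?d"
      using mult_cong_right[OF Q.closed[OF Q(2,3)] A(1) factor_mult_mem[OF Q(2,3) mem(1,2)] mem(3)] .
    finally show "(class_translation m rep (mQ X Y, Z, mQ (mQ X Y) Z) \<circ>
        class_translation m rep (X, Y, mQ X Y)) a =
      class_translation m rep (X, mQ Y Z, mQ X (mQ Y Z)) a"
      by (simp add: class_translation_def)
  qed
qed

lemma class_translation_eq_mult: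
  assumes rep: "\<And>X Y. \<lbrakk>X \<in> Q; Y \<in> Q\<rbrakk> \<Longrightarrow> rep X Y \<in> Y"
    and "c \<in> A" "d \<in> A"
  shows "class_translation m rep (\<theta> `` {c}, \<theta> `` {d}, Z) c = m c d"
proof -
  have Q: "\<theta> `` {c} \<in> Q" "\<theta> `` {d} \<in> Q" using assms(2,3) by (auto intro: quotientI)
  show ?thesis
    using mult_cong_right[OF Q(2) assms(2) rep[OF Q] mem_own_class[OF assms(3)]]
    by (simp add: class_translation_def)
qed

lemma derived_mult_of_classes:
  assumes rep: "\<And>X Y. \<lbrakk>X \<in> Q; Y \<in> Q\<rbrakk> \<Longrightarrow> rep X Y \<in> Y"
    and A: "c \<in> A" "d \<in> A"
  shows "derived_mult Q mQ (\<lambda>X. X) (class_translation m rep) c d = m c d"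
proof -
  interpret C: semigroup_construction Q mQ "\<lambda>X. X" "class_translation m rep"
    by (rule construction_of_classes[OF rep])
  show ?thesis
    using C.derived_mult_eq[OF quotientI[OF A(1)] quotientI[OF A(2)]] mem_own_class A
      class_translation_eq_mult[OF rep A] by simp
qed

lemma isomorphic_class_translation:
  assumes rep: "\<And>X Y. \<lbrakk>X \<in> Q; Y \<in> Q\<rbrakk> \<Longrightarrow> rep X Y \<in> Y"
  defines "circ \<equiv> \<lambda>c d. class_translation m rep (\<theta> `` {c}, \<theta> `` {d}, \<theta> `` {m c d}) c"
  shows "semigroup_on A circ" "isomorphic_on A circ A m"
proof -
  have eq: "circ c d = m c d" if "c \<in> A" "d \<in> A" for c d
    using class_translation_eq_mult[OF rep that] by (simp add: circ_def)
  show "semigroup_on A circ"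
    by (standard; simp add: eq closed assoc)
  show "isomorphic_on A circ A m"
    by (rule isomorphic_on_id) (rule eq)
qed

lemma isomorphic_to_derived:
  "\<exists>(F :: 'a set \<Rightarrow> 'a set) h. semigroup_construction Q mQ F h \<and>
     isomorphic_on A m (\<Union>X\<in>Q. F X) (derived_mult Q mQ F h)"
proof -
  define rep :: "'a set \<Rightarrow> 'a set \<Rightarrow> 'a" where "rep = (\<lambda>X Y. SOME b. b \<in> Y)"
  have rep: "rep X Y \<in> Y" if "X \<in> Q" "Y \<in> Q" for X Y
    using class_nonempty[OF that(2)] by (simp add: rep_def some_in_eq)
  have "isomorphic_on A m A (derived_mult Q mQ (\<lambda>X. X) (class_translation m rep))"
    by (rule isomorphic_on_id) (simp add: derived_mult_of_classes[OF rep])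
  moreover have "(\<Union>X\<in>Q. X) = A" using Union_quotient[OF equiv_theta] by simp
  ultimately have "isomorphic_on A m (\<Union>X\<in>Q. X)
      (derived_mult Q mQ (\<lambda>X. X) (class_translation m rep))"
    by (simp only:)
  with construction_of_classes[OF rep] show ?thesis
    by (intro exI conjI)
qed

end

section \<open>The structure theorem\<close>

theorem theorem2:
  fixes S :: "'s set" and mS :: "'s \<Rightarrow> 's \<Rightarrow> 's"
    and T :: "'s \<Rightarrow> 't set" and f :: "'s \<times> 's \<times> 's \<Rightarrow> 't \<Rightarrow> 't"
    and U :: "'u set" and mU :: "'u \<Rightarrow> 'u \<Rightarrow> 'u"
  shows
    "(semigroup_construction S mS T f \<longrightarrow>
       (let A = (\<Union>x\<in>S. T x); mA = derived_mult S mS T f in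
          semigroup_on A mA \<and>
          (\<forall>x\<in>S. \<exists>C \<in> A // theta A mA. T x \<subseteq> C) \<and>
          (left_reductive S mS \<longrightarrow> A // theta A mA = T ` S)))
     \<and>
     (semigroup_on U mU \<longrightarrow>
       (let \<theta> = theta U mU; Q = U // \<theta>; mQ = factor_mult \<theta> mU in
          congruence_on U mU \<theta> \<and>
          (\<forall>X\<in>Q. \<forall>Y\<in>Q. \<forall>a\<in>X. \<forall>b\<in>Y. \<forall>b'\<in>Y. mU a b = mU a b') \<and>
          (\<forall>rep. (\<forall>X\<in>Q. \<forall>Y\<in>Q. rep X Y \<in> Y) \<longrightarrow>
             (let g = class_translation mU rep;
                  circ = (\<lambda>c d. g (\<theta> `` {c}, \<theta> `` {d}, \<theta> `` {mU c d}) c)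
              in semigroup_on U circ \<and> isomorphic_on U circ U mU)) \<and>
          (\<exists>(F :: 'u set \<Rightarrow> 'u set) h.
             semigroup_construction Q mQ F h \<and>
             isomorphic_on U mU (\<Union>X\<in>Q. F X) (derived_mult Q mQ F h))))"
proof (intro conjI impI)
  assume "semigroup_construction S mS T f"
  then interpret semigroup_construction S mS T f .
  show "let A = (\<Union>x\<in>S. T x); mA = derived_mult S mS T f in
          semigroup_on A mA \<and>
          (\<forall>x\<in>S. \<exists>C \<in> A // theta A mA. T x \<subseteq> C) \<and>
          (left_reductive S mS \<longrightarrow> A // theta A mA = T ` S)"
    unfolding Let_def
    using semigroup_derived index_set_in_theta_class theta_classes_of_derived by blast
next
  assume "semigroup_on U mU"
  then interpret semigroup_on U mU .
  have indep: "\<forall>X\<in>Q. \<forall>Y\<in>Q. \<forall>a\<in>X. \<forall>b\<in>Y. \<forall>b'\<in>Y. mU a b = mU a b'"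
    using mult_cong_right class_eq by metis
  have transl: "\<forall>rep. (\<forall>X\<in>Q. \<forall>Y\<in>Q. rep X Y \<in> Y) \<longrightarrow>
      (let g = class_translation mU rep;
           circ = (\<lambda>c d. g (\<theta> `` {c}, \<theta> `` {d}, \<theta> `` {mU c d}) c)
       in semigroup_on U circ \<and> isomorphic_on U circ U mU)"
  proof (intro allI impI)
    fix rep assume "\<forall>X\<in>Q. \<forall>Y\<in>Q. rep X Y \<in> Y"
    then have rep: "\<And>X Y. \<lbrakk>X \<in> Q; Y \<in> Q\<rbrakk> \<Longrightarrow> rep X Y \<in> Y" by simp
    show "let g = class_translation mU rep;
           circ = (\<lambda>c d. g (\<theta> `` {c}, \<theta> `` {d}, \<theta> `` {mU c d}) c)
       in semigroup_on U circ \<and> isomorphic_on U circ U mU"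
      unfolding Let_def by (rule conjI[OF isomorphic_class_translation[OF rep]])
  qed
  show "let \<theta> = theta U mU; Q = U // \<theta>; mQ = factor_mult \<theta> mU in
          congruence_on U mU \<theta> \<and>
          (\<forall>X\<in>Q. \<forall>Y\<in>Q. \<forall>a\<in>X. \<forall>b\<in>Y. \<forall>b'\<in>Y. mU a b = mU a b') \<and>
          (\<forall>rep. (\<forall>X\<in>Q. \<forall>Y\<in>Q. rep X Y \<in> Y) \<longrightarrow>
             (let g = class_translation mU rep;
                  circ = (\<lambda>c d. g (\<theta> `` {c}, \<theta> `` {d}, \<theta> `` {mU c d}) c)
              in semigroup_on U circ \<and> isomorphic_on U circ U mU)) \<and>
          (\<exists>(F :: 'u set \<Rightarrow> 'u set) h.
             semigroup_construction Q mQ F h \<and>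
             isomorphic_on U mU (\<Union>X\<in>Q. F X) (derived_mult Q mQ F h))"
    unfolding Let_def
    by (intro conjI congruence_theta indep transl[unfolded Let_def] isomorphic_to_derived)
qed

end
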